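(* Assume that $T$ is continuous on $C$, that $S_*\neq\varnothing$ and that $S_*\subseteq S_{\rm dual}$. Let $(x^k)_{k\in\mathbb{N}}$ be an infinite sequence generated by Conceptual Algorithm F with Variant F.1, that is, $x^{k+1}=P_C\big(P_{H(\overline{x}^k,\bar v^k)}(x^k)\big)$, such that $x^k\notin S_*$ for all $k\in\mathbb{N}$. Then $(x^k)_{k\in\mathbb{N}}$ converges to a point in $S_*$.
   Context: $\mathbb{R}^n$ carries the Euclidean inner product $\langle\cdot,\cdot\rangle$ and norm $\|\cdot\|$; $\mathbb{N}=\{0,1,2,\dots\}$. $T:\operatorname{dom}(T)\subseteq\mathbb{R}^n\to\mathbb{R}^n$ is an operator and $C\subseteq\operatorname{dom}(T)$ is nonempty, closed and convex. $P_S$ is the orthogonal projection onto a nonempty closed convex set $S$. For $x\in C$, $\mathcal{N}_C(x)=\{u\in\mathbb{R}^n:\langle u,y-x\rangle\le 0\ \forall y\in C\}$. $S_*=\{x_*\in C:\langle T(x_* ),x-x_*\rangle\ge0\ \forall x\in C\}$ and $S_{\rm dual}=\{x_*\in C:\langle T(x),x-x_*\rangle\ge0\ \forall x\in C\}$. For $z\in C$ and $v\in\mathcal{N}_C(z)$, $H(z,v)=\{y\in\mathbb{R}^n:\langle T(z)+v,y-z\rangle\le0\}$. Conceptual Algorithm F. Fix $(\beta_k)_{k\in\mathbb{N}}\subset[\check\beta,\hat\beta]$ with $0<\check\beta\le\hat\beta<+\infty$, $\delta,\theta\in(0,1)$, $M>0$. Linesearch F, for input $x\in C$, $u\in\mathcal{N}_C(x)$,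 $\beta>0$: start with $\alpha=1$. For each trial $\alpha$ let $z_\alpha=P_C(x-\beta(T(x)+\alpha u))$ and choose any $v_\alpha\in\mathcal{N}_C(\alpha z_\alpha+(1-\alpha)x)$ with $\|v_\alpha\|\le M$. While $\langle T(\alpha z_\alpha+(1-\alpha)x)+v_\alpha,\,x-z_\alpha\rangle<\delta\langle T(x)+\alpha u,\,x-z_\alpha\rangle$, replace $\alpha$ by $\theta\alpha$ (and choose a new such $v_\alpha$). Output $(\alpha,z_\alpha,v_\alpha)$. Algorithm: take $x^0\in C$. At iteration $k$, stop if $x^k=P_C(x^k-T(x^k))$. Otherwise choose any $u^k\in\mathcal{N}_C(x^k)$ with $\|u^k\|\le M$, let $(\alpha_k,z^k,\bar v^k)$ be the output of Linesearch F for input $(x^k,u^k,\beta_k)$, set $\overline{x}^k=\alpha_kz^k+(1-\alpha_k)x^k$, and compute $x^{k+1}$ by the update rule of the chosen variant. *)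

theory Defs
  imports "HOL-Analysis.Analysis"
begin

text \<open>
  The projection onto a nonempty closed convex set \<open>S\<close> is the library's \<open>closest_point S\<close>.
  A partial operator \<open>T : dom(T) \<rightarrow> R^n\<close> is a total function of which only the values
  on \<open>C\<close>, a subset of \<open>dom(T)\<close>, are used.
\<close>

definition normal_cone :: "(real ^ 'n) set \<Rightarrow> real ^ 'n \<Rightarrow> (real ^ 'n) set" where
  "normal_cone C x = {u. \<forall>y\<in>C. u \<bullet> (y - x) \<le> 0}"

definition VI_solutions :: "(real ^ 'n \<Rightarrow> real ^ 'n) \<Rightarrow> (real ^ 'n) set \<Rightarrow> (real ^ 'n) set" where
  "VI_solutions T C = {xs \<in> C. \<forall>x\<in>C. T xs \<bullet> (x - xs) \<ge> 0}"

definition dual_solutions :: "(real ^ 'n \<Rightarrow> real ^ 'n) \<Rightarrow> (real ^ 'n) set \<Rightarrow> (real ^ 'n) set" where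
  "dual_solutions T C = {xs \<in> C. \<forall>x\<in>C. T x \<bullet> (x - xs) \<ge> 0}"

definition separating_halfspace ::
    "(real ^ 'n \<Rightarrow> real ^ 'n) \<Rightarrow> real ^ 'n \<Rightarrow> real ^ 'n \<Rightarrow> (real ^ 'n) set" where
  "separating_halfspace T z v = {y. (T z + v) \<bullet> (y - z) \<le> 0}"

definition trial_point ::
    "(real ^ 'n \<Rightarrow> real ^ 'n) \<Rightarrow> (real ^ 'n) set \<Rightarrow> real ^ 'n \<Rightarrow> real ^ 'n \<Rightarrow> real \<Rightarrow> real \<Rightarrow> real ^ 'n" where
  "trial_point T C x u \<beta> \<alpha> = closest_point C (x - \<beta> *\<^sub>R (T x + \<alpha> *\<^sub>R u))"

definition convex_step :: "real \<Rightarrow> real ^ 'n \<Rightarrow> real ^ 'n \<Rightarrow> real ^ 'n" where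
  "convex_step \<alpha> z x = \<alpha> *\<^sub>R z + (1 - \<alpha>) *\<^sub>R x"

text \<open>The condition of the while loop: the trial \<open>(\<alpha>, v)\<close> is rejected.\<close>

definition trial_rejected ::
    "(real ^ 'n \<Rightarrow> real ^ 'n) \<Rightarrow> (real ^ 'n) set \<Rightarrow> real \<Rightarrow> real ^ 'n \<Rightarrow> real ^ 'n \<Rightarrow> real
      \<Rightarrow> real \<Rightarrow> real ^ 'n \<Rightarrow> bool" where
  "trial_rejected T C \<delta> x u \<beta> \<alpha> v \<longleftrightarrow>
    (let z = trial_point T C x u \<beta> \<alpha>
     in (T (convex_step \<alpha> z x) + v) \<bullet> (x - z) < \<delta> * ((T x + \<alpha> *\<^sub>R u) \<bullet> (x - z)))"

definition admissible_normal ::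
    "(real ^ 'n \<Rightarrow> real ^ 'n) \<Rightarrow> (real ^ 'n) set \<Rightarrow> real \<Rightarrow> real ^ 'n \<Rightarrow> real ^ 'n \<Rightarrow> real
      \<Rightarrow> real \<Rightarrow> real ^ 'n \<Rightarrow> bool" where
  "admissible_normal T C M x u \<beta> \<alpha> v \<longleftrightarrow>
     v \<in> normal_cone C (convex_step \<alpha> (trial_point T C x u \<beta> \<alpha>) x) \<and> norm v \<le> M"

text \<open>
  The linesearch chooses a normal vector freely at every trial, so its runs are a relation:
  \<open>linesearch_reaches \<dots> \<alpha> v\<close> says that some run arrives at step size \<open>\<alpha>\<close> and picks \<open>v\<close> there,
  all earlier trials having been rejected.
\<close>

inductive linesearch_reaches ::
    "(real ^ 'n \<Rightarrow> real ^ 'n) \<Rightarrow> (real ^ 'n) set \<Rightarrow> real \<Rightarrow> real \<Rightarrow> real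
      \<Rightarrow> real ^ 'n \<Rightarrow> real ^ 'n \<Rightarrow> real \<Rightarrow> real \<Rightarrow> real ^ 'n \<Rightarrow> bool"
  for T C \<delta> \<theta> M x u \<beta> where
  start: "admissible_normal T C M x u \<beta> 1 v \<Longrightarrow> linesearch_reaches T C \<delta> \<theta> M x u \<beta> 1 v"
| shrink: "linesearch_reaches T C \<delta> \<theta> M x u \<beta> \<alpha> v \<Longrightarrow> trial_rejected T C \<delta> x u \<beta> \<alpha> v
    \<Longrightarrow> admissible_normal T C M x u \<beta> (\<theta> * \<alpha>) v'
    \<Longrightarrow> linesearch_reaches T C \<delta> \<theta> M x u \<beta> (\<theta> * \<alpha>) v'"

definition linesearch_F_output ::
    "(real ^ 'n \<Rightarrow> real ^ 'n) \<Rightarrow> (real ^ 'n) set \<Rightarrow> real \<Rightarrow> real \<Rightarrow> real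
      \<Rightarrow> real ^ 'n \<Rightarrow> real ^ 'n \<Rightarrow> real \<Rightarrow> real \<Rightarrow> real ^ 'n \<Rightarrow> real ^ 'n \<Rightarrow> bool" where
  "linesearch_F_output T C \<delta> \<theta> M x u \<beta> \<alpha> z v \<longleftrightarrow>
     linesearch_reaches T C \<delta> \<theta> M x u \<beta> \<alpha> v \<and> \<not> trial_rejected T C \<delta> x u \<beta> \<alpha> v \<and>
     z = trial_point T C x u \<beta> \<alpha>"

text \<open>
  Infinite sequences generated by the conceptual algorithm. The argument \<open>update\<close> is the update
  rule of the chosen variant; it maps \<open>x\<^sup>k\<close>, the point \<open>\<alpha>\<^sub>k z\<^sup>k + (1 - \<alpha>\<^sub>k) x\<^sup>k\<close> and the
  normal vector returned by the linesearch to the next iterate.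
\<close>

definition generated_by_algorithm_F ::
    "(real ^ 'n \<Rightarrow> real ^ 'n) \<Rightarrow> (real ^ 'n) set \<Rightarrow> (nat \<Rightarrow> real) \<Rightarrow> real \<Rightarrow> real \<Rightarrow> real
      \<Rightarrow> (real ^ 'n \<Rightarrow> real ^ 'n \<Rightarrow> real ^ 'n \<Rightarrow> real ^ 'n) \<Rightarrow> (nat \<Rightarrow> real ^ 'n) \<Rightarrow> bool" where
  "generated_by_algorithm_F T C \<beta> \<delta> \<theta> M update x \<longleftrightarrow>
     x 0 \<in> C \<and>
     (\<forall>k. x k \<noteq> closest_point C (x k - T (x k)) \<and>
       (\<exists>u \<alpha> z v. u \<in> normal_cone C (x k) \<and> norm u \<le> M \<and>
          linesearch_F_output T C \<delta> \<theta> M (x k) u (\<beta> k) \<alpha> z v \<and>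
          x (Suc k) = update (x k) (convex_step \<alpha> z (x k)) v))"

definition variant_F1 ::
    "(real ^ 'n \<Rightarrow> real ^ 'n) \<Rightarrow> (real ^ 'n) set \<Rightarrow> real ^ 'n \<Rightarrow> real ^ 'n \<Rightarrow> real ^ 'n \<Rightarrow> real ^ 'n" where
  "variant_F1 T C x xbar v = closest_point C (closest_point (separating_halfspace T xbar v) x)"

end

theory Submission
  imports Defs
begin

text \<open>
  Every solution lies in the separating halfspace used at iteration \<open>k\<close>, so projecting onto it and
  then onto \<open>C\<close> makes the sequence Fejer monotone with respect to \<open>S\<^sub>*\<close>, and the distance from \<open>x\<^sup>k\<close>
  to the halfspace tends to \<open>0\<close>. By the linesearch test this distance dominates
  \<open>\<alpha>\<^sub>k \<parallel>x\<^sup>k - z\<^sup>k\<parallel>\<^sup>2\<close> up to a constant. Pass to a subsequence along which all data converge. If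
  \<open>\<alpha>\<^sub>k\<close> has a positive limit, then \<open>x\<^sup>k - z\<^sup>k\<close> tends to \<open>0\<close> and the limit is a fixed point
  of the projected step. If \<open>\<alpha>\<^sub>k\<close> tends to \<open>0\<close>, then the rejected trials \<open>\<alpha>\<^sub>k / \<theta>\<close> give in the
  limit the reverse of the descent inequality, again forcing a fixed point. So some cluster point
  is a solution, and Fejer monotonicity makes it the limit.
\<close>

section \<open>Fejer monotonicity and metric projections\<close>

lemma Fejer_monotone_tendsto:
  fixes x :: "nat \<Rightarrow> 'a::metric_space"
  assumes "\<And>k. dist (x (Suc k)) l \<le> dist (x k) l"
    and "strict_mono r" and "(x \<circ> r) \<longlonglongrightarrow> l"
  shows "x \<longlonglongrightarrow> l"
proof (rule metric_LIMSEQ_I)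
  fix e :: real assume "e > 0"
  then obtain N where N: "dist (x (r N)) l < e"
    using assms(3) by (metis (no_types, lifting) comp_apply lim_sequentially order_refl)
  have "decseq (\<lambda>k. dist (x k) l)"
    using assms(1) by (rule decseq_SucI)
  then have "dist (x n) l < e" if "n \<ge> r N" for n
    using N decseqD[of "\<lambda>k. dist (x k) l", OF _ that] by fastforce
  then show "\<exists>no. \<forall>n\<ge>no. dist (x n) l < e" by blast
qed

text \<open>At the projection of \<open>x\<close>, the directions to \<open>x\<close> and to
  \<open>p\<close> form no acute angle. The subtracted square is what later forces the distances to
  the halfspaces to 0.\<close>

lemma dist_closest_point_square:
  fixes S :: "'a::euclidean_space set"
  assumes "closed S" "convex S" "p \<in> S"
  shows "(dist (closest_point S x) p)\<^sup>2 \<le> (dist x p)\<^sup>2 - (dist x (closest_point S x))\<^sup>2"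
proof -
  let ?w = "closest_point S x"
  have "(x - ?w) \<bullet> (p - ?w) \<le> 0"
    using assms by (simp add: closest_point_dot)
  then show ?thesis
    by (simp add: dist_norm power2_norm_eq_inner inner_diff inner_commute)
qed

text \<open>Since \<open>x\<close> lies in \<open>C\<close>, the variational inequality of the
  projection \<open>z\<close> can be tested at \<open>x\<close> itself.\<close>

lemma projected_step_descent:
  fixes C :: "'a::euclidean_space set" and d :: 'a and b :: real
  assumes "closed C" "convex C" "x \<in> C"
  defines "z \<equiv> closest_point C (x - b *\<^sub>R d)"
  shows "(norm (x - z))\<^sup>2 \<le> b * (d \<bullet> (x - z))"
proof -
  have "(x - b *\<^sub>R d - z) \<bullet> (x - z) \<le> 0"
    unfolding z_def using assms by (simp add: closest_point_dot)
  then show ?thesis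
    by (simp add: power2_norm_eq_inner inner_diff_left)
qed

lemma projected_step_norm_le:
  fixes C :: "'a::euclidean_space set"
  assumes "closed C" "convex C" "x \<in> C" "0 \<le> b"
  shows "norm (x - closest_point C (x - b *\<^sub>R d)) \<le> b * norm d"
proof -
  have "dist (closest_point C x) (closest_point C (x - b *\<^sub>R d)) \<le> dist x (x - b *\<^sub>R d)"
    using assms by (intro closest_point_lipschitz) auto
  then show ?thesis
    using assms by (simp add: dist_norm closest_point_self)
qed

section \<open>Trial points and the linesearch\<close>

lemma convex_step_in:
  assumes "convex C" "x \<in> C" "z \<in> C" "0 \<le> a" "a \<le> 1"
  shows "convex_step a z x \<in> C"
  using assms unfolding convex_step_def by (intro convexD) auto

lemma trial_point_in:
  assumes "closed C" "x \<in> C"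
  shows "trial_point T C x u b a \<in> C"
  using assms unfolding trial_point_def by (intro closest_point_in_set) auto

text \<open>The projection inequality has the direction \<open>T x\<close> plus \<open>a\<close>
  times \<open>u\<close>; as \<open>u\<close> pairs nonpositively with feasible directions, dropping
  it keeps the sign. The case \<open>a = 0\<close> serves vanishing step sizes.\<close>

lemma trial_point_fixed_imp_solution:
  assumes "closed C" "convex C" "x \<in> C" "u \<in> normal_cone C x" "0 \<le> a" "0 < b"
    and fix_eq: "trial_point T C x u b a = x"
  shows "x \<in> VI_solutions T C"
proof -
  have "T x \<bullet> (y - x) \<ge> 0" if "y \<in> C" for y
  proof -
    have "(x - b *\<^sub>R (T x + a *\<^sub>R u) - x) \<bullet> (y - x) \<le> 0"
      using closest_point_dot[OF assms(2,1) that, of "x - b *\<^sub>R (T x + a *\<^sub>R u)"] fix_eq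
      by (simp add: trial_point_def)
    then have "b * ((T x + a *\<^sub>R u) \<bullet> (y - x)) \<ge> 0"
      by simp
    then have "(T x + a *\<^sub>R u) \<bullet> (y - x) \<ge> 0"
      using \<open>0 < b\<close> by (simp add: zero_le_mult_iff)
    moreover have "a * (u \<bullet> (y - x)) \<le> 0"
      using assms(4,5) that by (auto simp: normal_cone_def mult_nonneg_nonpos)
    ultimately show ?thesis
      by (simp add: inner_add_left)
  qed
  with \<open>x \<in> C\<close> show ?thesis
    by (simp add: VI_solutions_def)
qed

text \<open>For each fixed \<open>y\<close> the defining inequality passes to the limit. Membership
  is asked only eventually, since rejected trials exist only from some index on.\<close>

lemma normal_cone_closed_graph:
  assumes "X \<longlonglongrightarrow> x" "U \<longlonglongrightarrow> u" "eventually (\<lambda>n. U n \<in> normal_cone C (X n)) sequentially"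
  shows "u \<in> normal_cone C x"
  unfolding normal_cone_def
proof safe
  fix y assume "y \<in> C"
  have "(\<lambda>n. U n \<bullet> (y - X n)) \<longlonglongrightarrow> u \<bullet> (y - x)"
    using assms by (intro tendsto_intros)
  moreover have "eventually (\<lambda>n. U n \<bullet> (y - X n) \<le> 0) sequentially"
    using assms(3) by eventually_elim (use \<open>y \<in> C\<close> in \<open>auto simp: normal_cone_def\<close>)
  ultimately show "u \<bullet> (y - x) \<le> 0"
    by (rule tendsto_upperbound) simp
qed

lemma tendsto_trial_point:
  assumes "closed C" "convex C" "continuous_on C T"
    and "X \<longlonglongrightarrow> x" "U \<longlonglongrightarrow> u" "B \<longlonglongrightarrow> b" "A \<longlonglongrightarrow> a" "\<And>n. X n \<in> C" "x \<in> C"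
  shows "(\<lambda>n. trial_point T C (X n) (U n) (B n) (A n)) \<longlonglongrightarrow> trial_point T C x u b a"
proof -
  have "(\<lambda>n. T (X n)) \<longlonglongrightarrow> T x"
    using assms by (intro continuous_on_tendsto_compose[OF assms(3,4)]) auto
  then have "(\<lambda>n. X n - B n *\<^sub>R (T (X n) + A n *\<^sub>R U n)) \<longlonglongrightarrow> x - b *\<^sub>R (T x + a *\<^sub>R u)"
    using assms by (intro tendsto_intros)
  moreover have "isCont (closest_point C) (x - b *\<^sub>R (T x + a *\<^sub>R u))"
    using assms by (intro continuous_at_closest_point) auto
  ultimately show ?thesis
    unfolding trial_point_def by (rule isCont_tendsto_compose[rotated])
qed

text \<open>Unless the first trial is accepted, the step size came from shrinking, so the trial just
  before it was rejected. This is the information left when the step sizes tend to 0.\<close>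

lemma linesearch_reaches_cases:
  assumes "linesearch_reaches T C \<delta> \<theta> M x u b \<alpha> v" "0 < \<theta>" "\<theta> < 1"
  shows "0 < \<alpha>" "\<alpha> \<le> 1" "admissible_normal T C M x u b \<alpha> v"
    and "\<alpha> = 1 \<or> \<alpha> / \<theta> \<le> 1 \<and>
      (\<exists>v'. admissible_normal T C M x u b (\<alpha> / \<theta>) v' \<and> trial_rejected T C \<delta> x u b (\<alpha> / \<theta>) v')"
proof -
  have "0 < \<alpha> \<and> \<alpha> \<le> 1 \<and> admissible_normal T C M x u b \<alpha> v \<and> (\<alpha> = 1 \<or> \<alpha> / \<theta> \<le> 1 \<and>
      (\<exists>v'. admissible_normal T C M x u b (\<alpha> / \<theta>) v' \<and> trial_rejected T C \<delta> x u b (\<alpha> / \<theta>) v'))"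
    using assms
  proof (induction rule: linesearch_reaches.induct)
    case (shrink \<alpha> v v')
    then have "0 < \<alpha>" "\<alpha> \<le> 1" by auto
    then have "\<theta> * \<alpha> \<le> 1 * 1"
      using shrink.prems by (intro mult_mono) auto
    then show ?case
      using shrink by auto
  qed auto
  then show "0 < \<alpha>" "\<alpha> \<le> 1" "admissible_normal T C M x u b \<alpha> v"
    and "\<alpha> = 1 \<or> \<alpha> / \<theta> \<le> 1 \<and>
      (\<exists>v'. admissible_normal T C M x u b (\<alpha> / \<theta>) v' \<and> trial_rejected T C \<delta> x u b (\<alpha> / \<theta>) v')"
    by auto
qed

text \<open>Chains \<open>projected_step_descent\<close> with the negated loop test; the factor
  \<alpha> is absorbed by replacing \<open>x - z\<close> with the displacement from \<open>x\<close>
  to the convex step.\<close>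

lemma accepted_trial_descent:
  assumes "closed C" "convex C" "x \<in> C" "0 \<le> b" "0 \<le> \<delta>" "0 \<le> \<alpha>"
    and acc: "\<not> trial_rejected T C \<delta> x u b \<alpha> v"
  defines "z \<equiv> trial_point T C x u b \<alpha>"
  shows "\<delta> * \<alpha> * (norm (x - z))\<^sup>2
    \<le> b * ((T (convex_step \<alpha> z x) + v) \<bullet> (x - convex_step \<alpha> z x))"
proof -
  let ?g = "T (convex_step \<alpha> z x) + v" and ?d = "T x + \<alpha> *\<^sub>R u"
  have "(norm (x - z))\<^sup>2 \<le> b * (?d \<bullet> (x - z))"
    unfolding z_def trial_point_def using assms(1-3) by (rule projected_step_descent)
  then have "\<delta> * \<alpha> * (norm (x - z))\<^sup>2 \<le> (\<delta> * \<alpha>) * (b * (?d \<bullet> (x - z)))"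
    using assms by (intro mult_left_mono) auto
  also have "\<dots> = (\<alpha> * b) * (\<delta> * (?d \<bullet> (x - z)))"
    by simp
  also have "\<dots> \<le> (\<alpha> * b) * (?g \<bullet> (x - z))"
    using acc assms by (intro mult_left_mono) (auto simp: trial_rejected_def Let_def z_def)
  also have "\<dots> = b * (?g \<bullet> (\<alpha> *\<^sub>R (x - z)))"
    by simp
  also have "\<alpha> *\<^sub>R (x - z) = x - convex_step \<alpha> z x"
    by (simp add: convex_step_def algebra_simps)
  finally show ?thesis .
qed

section \<open>Separating halfspaces and the step of Variant F.1\<close>

lemma separating_halfspace_halfspace:
  "separating_halfspace T z v = {y. (T z + v) \<bullet> y \<le> (T z + v) \<bullet> z}"
  by (simp add: separating_halfspace_def inner_diff_right)

lemma separating_halfspace_closed: "closed (separating_halfspace T z v)"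
  by (simp add: separating_halfspace_halfspace closed_halfspace_le)

lemma separating_halfspace_convex: "convex (separating_halfspace T z v)"
  by (simp add: separating_halfspace_halfspace convex_halfspace_le)

lemma self_mem_separating_halfspace: "z \<in> separating_halfspace T z v"
  by (simp add: separating_halfspace_def)

lemma dual_solution_in_separating_halfspace:
  assumes "p \<in> dual_solutions T C" "z \<in> C" "v \<in> normal_cone C z"
  shows "p \<in> separating_halfspace T z v"
proof -
  have "T z \<bullet> (z - p) \<ge> 0" "v \<bullet> (p - z) \<le> 0"
    using assms by (auto simp: dual_solutions_def normal_cone_def)
  then show ?thesis
    by (simp add: separating_halfspace_def inner_diff_right inner_add_left)
qed

text \<open>Cauchy-Schwarz replaces the explicit projection formula, so a vanishing
  \<open>T z + v\<close> needs no separate case.\<close>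

lemma separating_halfspace_distance:
  "(T z + v) \<bullet> (x - z)
    \<le> norm (T z + v) * dist x (closest_point (separating_halfspace T z v) x)"
proof -
  let ?w = "closest_point (separating_halfspace T z v) x"
  have "?w \<in> separating_halfspace T z v"
    using self_mem_separating_halfspace separating_halfspace_closed
    by (metis closest_point_in_set empty_iff)
  then have "(T z + v) \<bullet> (x - z) \<le> (T z + v) \<bullet> (x - ?w)"
    by (simp add: separating_halfspace_def inner_diff_right)
  also have "\<dots> \<le> norm (T z + v) * dist x ?w"
    unfolding dist_norm by (rule norm_cauchy_schwarz)
  finally show ?thesis .
qed

text \<open>The projection onto \<open>C\<close> cannot increase the distance to \<open>p\<close>,
  so the gain of the halfspace projection survives.\<close>

lemma variant_F1_Fejer:
  assumes "closed C" "convex C" "p \<in> C" "p \<in> separating_halfspace T z v"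
  shows "(dist (variant_F1 T C x z v) p)\<^sup>2
    \<le> (dist x p)\<^sup>2 - (dist x (closest_point (separating_halfspace T z v) x))\<^sup>2"
proof -
  let ?w = "closest_point (separating_halfspace T z v) x"
  have "(dist (variant_F1 T C x z v) p)\<^sup>2 \<le> (dist ?w p)\<^sup>2"
    using dist_closest_point_square[OF assms(1-3), of ?w] zero_le_power2[of "dist ?w (closest_point C ?w)"]
    unfolding variant_F1_def by linarith
  also have "\<dots> \<le> (dist x p)\<^sup>2 - (dist x ?w)\<^sup>2"
    by (intro dist_closest_point_square separating_halfspace_closed separating_halfspace_convex assms)
  finally show ?thesis .
qed

text \<open>As the step sizes vanish, the failed test becomes an inequality at \<open>x\<close>
  alone. With \<delta> < 1 it contradicts the descent of the projected step unless that step leaves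
  \<open>x\<close> fixed.\<close>

lemma rejected_trials_limit:
  assumes "closed C" "convex C" "continuous_on C T" "\<delta> < 1" "0 < b"
    and lim: "X \<longlonglongrightarrow> x" "U \<longlonglongrightarrow> u" "B \<longlonglongrightarrow> b" "A \<longlonglongrightarrow> 0" "V \<longlonglongrightarrow> v"
    and XC: "\<And>n. X n \<in> C" and "x \<in> C" and "u \<in> normal_cone C x"
    and rej: "eventually (\<lambda>n. 0 \<le> A n \<and> A n \<le> 1 \<and>
      admissible_normal T C M (X n) (U n) (B n) (A n) (V n) \<and>
      trial_rejected T C \<delta> (X n) (U n) (B n) (A n) (V n)) sequentially"
  shows "x \<in> VI_solutions T C"
proof -
  define Z where "Z n = trial_point T C (X n) (U n) (B n) (A n)" for n
  define Y where "Y n = convex_step (A n) (Z n) (X n)" for n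
  define z where "z = trial_point T C x u b 0"
  have Z: "Z \<longlonglongrightarrow> z"
    unfolding Z_def z_def by (intro tendsto_trial_point assms)
  have zC: "z \<in> C"
    using assms by (simp add: z_def trial_point_in)
  have "Y \<longlonglongrightarrow> 0 *\<^sub>R z + (1 - 0) *\<^sub>R x"
    unfolding Y_def convex_step_def by (intro tendsto_intros lim Z)
  then have Y: "Y \<longlonglongrightarrow> x"
    by simp
  \<comment> \<open>\<open>T\<close> is continuous only on \<open>C\<close>, so feasibility of
    \<open>Y n\<close> is needed before passing to the limit in \<open>T (Y n)\<close>.\<close>
  have YC: "eventually (\<lambda>n. Y n \<in> C) sequentially"
    using rej by eventually_elim
      (auto simp: Y_def Z_def intro!: convex_step_in trial_point_in assms)
  have TY: "(\<lambda>n. T (Y n)) \<longlonglongrightarrow> T x"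
    by (intro continuous_on_tendsto_compose[OF assms(3) Y] YC \<open>x \<in> C\<close>)
  have TX: "(\<lambda>n. T (X n)) \<longlonglongrightarrow> T x"
    using XC by (intro continuous_on_tendsto_compose[OF assms(3) lim(1)] \<open>x \<in> C\<close>) simp
  have "v \<in> normal_cone C x"
  proof (rule normal_cone_closed_graph[OF Y lim(5)])
    show "eventually (\<lambda>n. V n \<in> normal_cone C (Y n)) sequentially"
      using rej by eventually_elim (auto simp: Y_def Z_def admissible_normal_def)
  qed
  \<comment> \<open>This sign lets the limit normal \<open>v\<close> be discarded from the left side
    of the failed test.\<close>
  then have vz: "v \<bullet> (x - z) \<ge> 0"
    using zC by (auto simp: normal_cone_def inner_diff_right)
  have "(\<lambda>n. (T (Y n) + V n) \<bullet> (X n - Z n)) \<longlonglongrightarrow> (T x + v) \<bullet> (x - z)"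
    by (intro tendsto_intros TY lim Z)
  moreover have "(\<lambda>n. \<delta> * ((T (X n) + A n *\<^sub>R U n) \<bullet> (X n - Z n)))
      \<longlonglongrightarrow> \<delta> * ((T x + 0 *\<^sub>R u) \<bullet> (x - z))"
    by (intro tendsto_intros TX lim Z)
  moreover have "eventually (\<lambda>n. (T (Y n) + V n) \<bullet> (X n - Z n)
      \<le> \<delta> * ((T (X n) + A n *\<^sub>R U n) \<bullet> (X n - Z n))) sequentially"
    using rej by eventually_elim (auto simp: trial_rejected_def Let_def Y_def Z_def)
  ultimately have "(T x + v) \<bullet> (x - z) \<le> \<delta> * ((T x + 0 *\<^sub>R u) \<bullet> (x - z))"
    by (intro tendsto_le[OF sequentially_bot])
  with vz have "(1 - \<delta>) * (T x \<bullet> (x - z)) \<le> 0"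
    by (simp add: inner_add_left algebra_simps)
  then have "T x \<bullet> (x - z) \<le> 0"
    using \<open>\<delta> < 1\<close> by (simp add: mult_le_0_iff)
  then have "b * (T x \<bullet> (x - z)) \<le> 0"
    using \<open>0 < b\<close> by (simp add: mult_le_0_iff)
  moreover have "(norm (x - z))\<^sup>2 \<le> b * (T x \<bullet> (x - z))"
    using projected_step_descent[OF assms(1,2) \<open>x \<in> C\<close>, of b "T x"]
    by (simp add: z_def trial_point_def)
  ultimately have "(norm (x - z))\<^sup>2 \<le> 0"
    by linarith
  then have "trial_point T C x u b 0 = x"
    by (simp add: z_def)
  then show ?thesis
    using assms by (intro trial_point_fixed_imp_solution[of C x u 0 b]) auto
qed


section \<open>Convergence of the iterates\<close>

theorem theorem4p6:
  fixes T :: "real ^ 'n \<Rightarrow> real ^ 'n"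
    and domT C :: "(real ^ 'n) set"
    and \<beta> :: "nat \<Rightarrow> real"
    and \<beta>min \<beta>max \<delta> \<theta> M :: real
    and x :: "nat \<Rightarrow> real ^ 'n"
  assumes "C \<subseteq> domT" and "C \<noteq> {}" and "closed C" and "convex C"
    and "0 < \<beta>min" and "\<beta>min \<le> \<beta>max" and "\<And>k. \<beta> k \<in> {\<beta>min..\<beta>max}"
    and "\<delta> \<in> {0<..<1}" and "\<theta> \<in> {0<..<1}" and "M > 0"
    and "continuous_on C T"
    and "VI_solutions T C \<noteq> {}"
    and "VI_solutions T C \<subseteq> dual_solutions T C"
    and "generated_by_algorithm_F T C \<beta> \<delta> \<theta> M (variant_F1 T C) x"
    and "\<And>k. x k \<notin> VI_solutions T C"
  shows "\<exists>l\<in>VI_solutions T C. x \<longlonglongrightarrow> l"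
proof -
  have \<delta>: "0 < \<delta>" "\<delta> < 1" and \<theta>: "0 < \<theta>" "\<theta> < 1"
    using assms(8,9) by auto
  have \<beta>: "0 < \<beta> k" "\<beta> k \<le> \<beta>max" for k
    using assms(5) assms(7)[of k] by auto
  have x0: "x 0 \<in> C" and step: "\<exists>u \<alpha> z v. u \<in> normal_cone C (x k) \<and> norm u \<le> M \<and>
      linesearch_F_output T C \<delta> \<theta> M (x k) u (\<beta> k) \<alpha> z v \<and>
      x (Suc k) = variant_F1 T C (x k) (convex_step \<alpha> z (x k)) v" for k
    using assms(14) unfolding generated_by_algorithm_F_def by auto
  obtain u \<alpha> z v where u: "\<And>k. u k \<in> normal_cone C (x k)" "\<And>k. norm (u k) \<le> M"
    and out: "\<And>k. linesearch_F_output T C \<delta> \<theta> M (x k) (u k) (\<beta> k) (\<alpha> k) (z k) (v k)"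
    and upd: "\<And>k. x (Suc k) = variant_F1 T C (x k) (convex_step (\<alpha> k) (z k) (x k)) (v k)"
    using step by metis
  define y where "y k = convex_step (\<alpha> k) (z k) (x k)" for k
  define w where "w k = closest_point (separating_halfspace T (y k) (v k)) (x k)" for k
  have reach: "linesearch_reaches T C \<delta> \<theta> M (x k) (u k) (\<beta> k) (\<alpha> k) (v k)"
    and acc: "\<not> trial_rejected T C \<delta> (x k) (u k) (\<beta> k) (\<alpha> k) (v k)"
    and z: "z k = trial_point T C (x k) (u k) (\<beta> k) (\<alpha> k)" for k
    using out[of k] by (auto simp: linesearch_F_output_def)
  note ls = linesearch_reaches_cases[OF reach \<theta>]
  have xC: "x k \<in> C" for k
  proof (cases k)
    case (Suc j)
    then show ?thesis
      using upd[of j] assms(2,3) by (simp add: variant_F1_def closest_point_in_set)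
  qed (simp add: x0)
  have zC: "z k \<in> C" for k
    using xC assms(3) by (simp add: z trial_point_in)
  have yC: "y k \<in> C" for k
    unfolding y_def using ls(1,2)[of k] xC zC assms(4) by (intro convex_step_in) auto
  have v: "v k \<in> normal_cone C (y k)" "norm (v k) \<le> M" for k
    using ls(3)[of k] by (auto simp: admissible_normal_def y_def z)
  \<comment> \<open>Here the inclusion of the solutions in the dual solutions enters: it places each
    solution in every separating halfspace.\<close>
  have Fejer: "(dist (x (Suc k)) p)\<^sup>2 \<le> (dist (x k) p)\<^sup>2 - (dist (x k) (w k))\<^sup>2"
    if "p \<in> VI_solutions T C" for p k
  proof -
    have "p \<in> dual_solutions T C"
      using that assms(13) by auto
    then have "p \<in> C" "p \<in> separating_halfspace T (y k) (v k)"
      using dual_solution_in_separating_halfspace[OF _ yC v(1)] by (auto simp: dual_solutions_def)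
    then show ?thesis
      using variant_F1_Fejer[OF assms(3,4)] by (simp add: upd y_def w_def)
  qed
  have mono: "dist (x (Suc k)) p \<le> dist (x k) p" if "p \<in> VI_solutions T C" for p k
  proof (rule power2_le_imp_le)
    show "(dist (x (Suc k)) p)\<^sup>2 \<le> (dist (x k) p)\<^sup>2"
      using Fejer[OF that, of k] zero_le_power2[of "dist (x k) (w k)"] by linarith
  qed simp
  obtain p where p: "p \<in> VI_solutions T C"
    using assms(12) by auto
  define R where "R = dist (x 0) p"
  have dec: "decseq (\<lambda>k. dist (x k) p)"
    using mono[OF p] by (rule decseq_SucI)
  then have xR: "dist (x k) p \<le> R" for k
    unfolding R_def by (auto dest: decseqD)
  \<comment> \<open>The radius stays free because two are used: \<open>R\<close> for the iterates
    and a larger one for the points \<open>y k\<close>.\<close>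
  have T_bounded: "\<exists>K. \<forall>y\<in>C. dist y p \<le> r \<longrightarrow> norm (T y) \<le> K" for r
  proof -
    have "compact (C \<inter> cball p r)"
      using assms(3) by (simp add: closed_Int_compact)
    then have "bounded (T ` (C \<inter> cball p r))"
      using assms(11) by (meson compact_continuous_image compact_imp_bounded
          continuous_on_subset inf_le1)
    then obtain K where "\<forall>y\<in>T ` (C \<inter> cball p r). norm y \<le> K"
      unfolding bounded_iff by blast
    then show ?thesis
      by (intro exI[of _ K]) (simp add: dist_commute)
  qed
  obtain K where K: "\<And>y. y \<in> C \<Longrightarrow> dist y p \<le> R \<Longrightarrow> norm (T y) \<le> K"
    using T_bounded by blast
  have xz: "norm (x k - z k) \<le> \<beta>max * (K + M)" for k
  proof -
    have "norm (\<alpha> k *\<^sub>R u k) \<le> 1 * M"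
      unfolding norm_scaleR using ls(1,2)[of k] u(2)[of k] by (intro mult_mono) auto
    then have "norm (T (x k) + \<alpha> k *\<^sub>R u k) \<le> K + M"
      using K[OF xC xR, of k] norm_triangle_ineq[of "T (x k)" "\<alpha> k *\<^sub>R u k"] by linarith
    then have "\<beta> k * norm (T (x k) + \<alpha> k *\<^sub>R u k) \<le> \<beta>max * (K + M)"
      using \<beta>[of k] by (intro mult_mono) auto
    moreover have "norm (x k - z k) \<le> \<beta> k * norm (T (x k) + \<alpha> k *\<^sub>R u k)"
      unfolding z trial_point_def using \<beta>(1)[of k]
      by (intro projected_step_norm_le assms(3,4) xC) auto
    ultimately show ?thesis
      by linarith
  qed
  \<comment> \<open>\<open>y k\<close> lies on the segment from \<open>x k\<close> to
    \<open>z k\<close>, whose length \<open>xz\<close> bounds.\<close>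
  have yR: "dist (y k) p \<le> R + \<beta>max * (K + M)" for k
  proof -
    have "y k - x k = \<alpha> k *\<^sub>R (z k - x k)"
      by (simp add: y_def convex_step_def algebra_simps)
    then have "dist (y k) (x k) \<le> 1 * norm (z k - x k)"
      unfolding dist_norm using ls(1,2)[of k] by (auto intro!: mult_left_le_one_le)
    then show ?thesis
      using xz[of k] xR[of k] dist_triangle[of "y k" p "x k"] by (simp add: norm_minus_commute)
  qed
  obtain L where L: "\<And>k. norm (T (y k)) \<le> L"
    using T_bounded[of "R + \<beta>max * (K + M)"] yC yR by blast
  have descent: "\<delta> * \<alpha> k * (norm (x k - z k))\<^sup>2 \<le> \<beta>max * ((L + M) * dist (x k) (w k))" for k
  proof -
    have "norm (T (y k) + v k) \<le> L + M"
      using L[of k] v(2)[of k] norm_triangle_ineq[of "T (y k)" "v k"] by linarith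
    then have "norm (T (y k) + v k) * dist (x k) (w k) \<le> (L + M) * dist (x k) (w k)"
      by (intro mult_right_mono) auto
    then have le: "(T (y k) + v k) \<bullet> (x k - y k) \<le> (L + M) * dist (x k) (w k)"
      using separating_halfspace_distance[of T "y k" "v k" "x k"] unfolding w_def by linarith
    have "\<delta> * \<alpha> k * (norm (x k - z k))\<^sup>2 \<le> \<beta> k * ((T (y k) + v k) \<bullet> (x k - y k))"
      using accepted_trial_descent[OF assms(3,4) xC _ _ _ acc] \<beta>(1)[of k] \<delta>(1) ls(1)[of k]
      by (simp add: y_def z)
    also have "\<dots> \<le> \<beta> k * ((L + M) * dist (x k) (w k))"
      using le \<beta>(1)[of k] by (intro mult_left_mono) auto
    also have "\<dots> \<le> \<beta>max * ((L + M) * dist (x k) (w k))"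
      using L[of k] \<beta>(2)[of k] assms(10) norm_ge_zero[of "T (y k)"]
      by (intro mult_right_mono mult_nonneg_nonneg) (auto simp del: norm_ge_zero)
    finally show ?thesis .
  qed
  obtain d where d: "(\<lambda>k. dist (x k) p) \<longlonglongrightarrow> d"
    using decseq_convergent[OF dec, of 0] by auto
  \<comment> \<open>The Fejer inequality bounds the squared distance to the halfspace by this
    difference of consecutive terms of a convergent sequence.\<close>
  have "(\<lambda>k. (dist (x k) p)\<^sup>2 - (dist (x (Suc k)) p)\<^sup>2) \<longlonglongrightarrow> d\<^sup>2 - d\<^sup>2"
    using d LIMSEQ_Suc[OF d] by (intro tendsto_intros)
  then have "(\<lambda>k. (dist (x k) p)\<^sup>2 - (dist (x (Suc k)) p)\<^sup>2) \<longlonglongrightarrow> 0"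
    by simp
  then have "(\<lambda>k. (dist (x k) (w k))\<^sup>2) \<longlonglongrightarrow> 0"
  proof (rule Lim_null_comparison[rotated])
    show "\<forall>\<^sub>F k in sequentially. norm ((dist (x k) (w k))\<^sup>2)
        \<le> (dist (x k) p)\<^sup>2 - (dist (x (Suc k)) p)\<^sup>2"
      using Fejer[OF p] by (intro always_eventually) (auto simp: algebra_simps)
  qed
  then have xw: "(\<lambda>k. dist (x k) (w k)) \<longlonglongrightarrow> 0"
    by simp
  have null: "(\<lambda>k. \<alpha> k * (norm (x k - z k))\<^sup>2) \<longlonglongrightarrow> 0"
  proof (rule Lim_null_comparison)
    show "(\<lambda>k. \<beta>max * ((L + M) * dist (x k) (w k)) / \<delta>) \<longlonglongrightarrow> 0"
      using tendsto_mult_right_zero[OF xw, of "\<beta>max * (L + M) / \<delta>"] by (simp add: mult_ac)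
    show "\<forall>\<^sub>F k in sequentially. norm (\<alpha> k * (norm (x k - z k))\<^sup>2)
        \<le> \<beta>max * ((L + M) * dist (x k) (w k)) / \<delta>"
      using descent \<delta>(1) ls(1)
      by (intro always_eventually) (auto simp: pos_le_divide_eq mult_ac abs_mult less_imp_le)
  qed
  \<comment> \<open>If \<alpha> = 1 there may be no rejected trial; \<open>v k\<close> then serves
    as a bounded filler, so that compactness applies at every index.\<close>
  have "\<exists>v'. norm v' \<le> M \<and> (\<alpha> k = 1 \<or> \<alpha> k / \<theta> \<le> 1 \<and>
      admissible_normal T C M (x k) (u k) (\<beta> k) (\<alpha> k / \<theta>) v' \<and>
      trial_rejected T C \<delta> (x k) (u k) (\<beta> k) (\<alpha> k / \<theta>) v')" for k
    using ls(4)[of k] v(2)[of k] by (auto simp: admissible_normal_def)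
  then obtain v' where v': "\<And>k. norm (v' k) \<le> M"
    "\<And>k. \<alpha> k = 1 \<or> \<alpha> k / \<theta> \<le> 1 \<and>
      admissible_normal T C M (x k) (u k) (\<beta> k) (\<alpha> k / \<theta>) (v' k) \<and>
      trial_rejected T C \<delta> (x k) (u k) (\<beta> k) (\<alpha> k / \<theta>) (v' k)"
    by metis
  \<comment> \<open>The last interval includes 0, since step sizes may vanish; the one for \<beta>
    stays away from 0, so \<open>bl\<close> is positive.\<close>
  define D where "D = cball p R \<times> cball (0::real^'n) M \<times> cball (0::real^'n) M
    \<times> {\<beta>min..\<beta>max} \<times> {0..1::real}"
  have "compact D"
    unfolding D_def by (intro compact_Times compact_cball compact_Icc)
  then have "seq_compact D"
    by (rule compact_imp_seq_compact)
  moreover have "\<forall>k. (x k, u k, v' k, \<beta> k, \<alpha> k) \<in> D"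
  proof
    fix k show "(x k, u k, v' k, \<beta> k, \<alpha> k) \<in> D"
      using xR[of k] u(2)[of k] v'(1)[of k] assms(7)[of k] ls(1,2)[of k]
      by (auto simp: D_def dist_commute)
  qed
  ultimately obtain l r where l: "l \<in> D" and r: "strict_mono r"
    and lim: "((\<lambda>k. (x k, u k, v' k, \<beta> k, \<alpha> k)) \<circ> r) \<longlonglongrightarrow> l"
    by (rule seq_compactE)
  obtain xl ul vl bl al where l_eq: "l = (xl, ul, vl, bl, al)"
    by (metis prod.exhaust)
  note lim2 = tendsto_snd[OF lim] and lim3 = tendsto_snd[OF tendsto_snd[OF lim]]
    and lim4 = tendsto_snd[OF tendsto_snd[OF tendsto_snd[OF lim]]]
  have xl: "(\<lambda>n. x (r n)) \<longlonglongrightarrow> xl" and ul: "(\<lambda>n. u (r n)) \<longlonglongrightarrow> ul"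
    and vl: "(\<lambda>n. v' (r n)) \<longlonglongrightarrow> vl" and bl: "(\<lambda>n. \<beta> (r n)) \<longlonglongrightarrow> bl"
    and al: "(\<lambda>n. \<alpha> (r n)) \<longlonglongrightarrow> al"
    using tendsto_fst[OF lim] tendsto_fst[OF lim2] tendsto_fst[OF lim3] tendsto_fst[OF lim4]
      tendsto_snd[OF lim4]
    by (simp_all add: o_def l_eq)
  have "0 < bl" "0 \<le> al"
    using l assms(5) by (auto simp: l_eq D_def)
  have xlC: "xl \<in> C"
    using closed_sequentially[OF assms(3) _ xl] xC by blast
  have ulN: "ul \<in> normal_cone C xl"
    using normal_cone_closed_graph[OF xl ul] u(1) by simp
  have "xl \<in> VI_solutions T C"
  proof (cases "al = 0")
    \<comment> \<open>A nonzero limit of the step sizes can be cancelled from the limit of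
      \<open>null\<close>.\<close>
    case False
    have "(\<lambda>n. z (r n)) \<longlonglongrightarrow> trial_point T C xl ul bl al"
      unfolding z by (intro tendsto_trial_point assms(3,4,11) xl ul bl al xC xlC)
    then have "(\<lambda>n. \<alpha> (r n) * (norm (x (r n) - z (r n)))\<^sup>2)
        \<longlonglongrightarrow> al * (norm (xl - trial_point T C xl ul bl al))\<^sup>2"
      by (intro tendsto_intros al xl)
    moreover have "(\<lambda>n. \<alpha> (r n) * (norm (x (r n) - z (r n)))\<^sup>2) \<longlonglongrightarrow> 0"
      using LIMSEQ_subseq_LIMSEQ[OF null r] by (simp add: o_def)
    ultimately have "al * (norm (xl - trial_point T C xl ul bl al))\<^sup>2 = 0"
      by (rule LIMSEQ_unique)
    with False have "trial_point T C xl ul bl al = xl"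
      by simp
    then show ?thesis
      using assms(3,4) xlC ulN \<open>0 \<le> al\<close> \<open>0 < bl\<close>
      by (intro trial_point_fixed_imp_solution[of C xl ul al bl]) auto
  next
    case True
    have A: "(\<lambda>n. \<alpha> (r n) / \<theta>) \<longlonglongrightarrow> 0"
      using tendsto_divide[OF al tendsto_const, of \<theta>] \<theta> True by simp
    \<comment> \<open>This excludes acceptance at the first trial, leaving the rejected alternative
      in \<open>v'\<close>.\<close>
    have "eventually (\<lambda>n. \<alpha> (r n) < 1) sequentially"
      using al True by (intro order_tendstoD(2)[of _ al]) auto
    then have "eventually (\<lambda>n. 0 \<le> \<alpha> (r n) / \<theta> \<and> \<alpha> (r n) / \<theta> \<le> 1 \<and>
        admissible_normal T C M (x (r n)) (u (r n)) (\<beta> (r n)) (\<alpha> (r n) / \<theta>) (v' (r n)) \<and>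
        trial_rejected T C \<delta> (x (r n)) (u (r n)) (\<beta> (r n)) (\<alpha> (r n) / \<theta>) (v' (r n)))
        sequentially"
    proof eventually_elim
      case (elim n)
      then show ?case
        using v'(2)[of "r n"] ls(1)[of "r n"] \<theta> by auto
    qed
    with assms(3,4,11) \<delta>(2) \<open>0 < bl\<close> xl ul bl A vl xC xlC ulN show ?thesis
      by (rule rejected_trials_limit)
  qed
  \<comment> \<open>Now that \<open>xl\<close> is known to be a solution, Fejer monotonicity holds
    relative to \<open>xl\<close> itself and upgrades subsequential to full convergence.\<close>
  moreover from this have "x \<longlonglongrightarrow> xl"
    using r xl by (intro Fejer_monotone_tendsto[of x xl r] mono) (simp_all add: o_def)
  ultimately show ?thesis
    by blast
qed

end
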